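(* Let $Q$ be the equioriented quiver of type $A_n$, with vertices $1,\dots,n$ and arrows $i\to i+1$. Let $A=\mathbb{C}Q$ be its path algebra, viewed as a representation of $Q$ (so $A\simeq\bigoplus_{i=1}^nP_i$), and let $A^*$ be its linear dual (so $A^*\simeq\bigoplus_{i=1}^nI_i$). Then the quiver Grassmannian $\mathrm{Gr}_{\mathbf{dim}\,A}(A\oplus A^* )$ is isomorphic to the complete degenerate flag variety $\mathcal{F}^a_{n+1}$ of $\mathfrak{sl}_{n+1}$.
   Context: $P_i$ and $I_i$ are the indecomposable projective and injective representations of $Q$ at vertex $i$: $\mathbf{dim}\,P_i=(0,\dots,0,1,\dots,1)$ with $i-1$ zeros and $\mathbf{dim}\,I_i=(1,\dots,1,0,\dots,0)$ with $n-i$ zeros. For a representation $M$ of $Q$ and a dimension vector $\mathbf{e}$, $\mathrm{Gr}_{\mathbf{e}}(M)\subset\prod_i\mathrm{Gr}_{e_i}(M_i)$ is the quiver Grassmannian parametrizing collections of subspaces $V_i\subset M_i$ with $\dim V_i=e_i$ and $M_\alpha V_i\subset V_j$ for all arrows $\alpha:i\to j$. Let $W$ be an $(n+1)$-dimensional complex vector space with basis $w_1,\dots,w_{n+1}$ and let $pr_k:W\to W$ be the projection $pr_k(\sum_ic_iw_i)=\sum_{i\neq k}c_iw_i$. The complete degenerate flag variety $\mathcal{F}^a_{n+1}$ is the variety of collections $(V_1,\dots,V_n)$ of subspaces $V_i\subset W$ with $\dim V_i=i$ and $pr_{i+1}V_i\subset V_{i+1}$ for $i=1,\dots,n-1$.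 *)

theory Defs
  imports
    Complex_Main
    "HOL-Library.FuncSet"
    "HOL-Library.Function_Algebras"
    "Jordan_Normal_Form.Determinant"
begin

text \<open>
  All complex vector spaces below are linear subspaces of a function space \<open>'x \<Rightarrow> complex\<close>,
  for an arbitrary index type \<open>'x\<close>.
\<close>

definition cscale :: "complex \<Rightarrow> ('x \<Rightarrow> complex) \<Rightarrow> ('x \<Rightarrow> complex)" where
  "cscale c f = (\<lambda>x. c * f x)"

global_interpretation cvec: vector_space "cscale :: complex \<Rightarrow> ('x \<Rightarrow> complex) \<Rightarrow> _"
  by unfold_locales (auto simp: cscale_def fun_eq_iff algebra_simps)


section \<open>Varieties as spaces with functions\<close>

text \<open>
  A variety is treated as its set of closed points with the Zariski topology and, for every open
  set, the regular functions on it.  Elements of \<open>reg X U\<close> are total functions of which only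
  the values on \<open>U\<close> matter.
\<close>

record 'p fun_space =
  pts :: "'p set"
  opens :: "'p set set"
  reg :: "'p set \<Rightarrow> ('p \<Rightarrow> complex) set"

definition morphism :: "'p fun_space \<Rightarrow> 'q fun_space \<Rightarrow> ('p \<Rightarrow> 'q) \<Rightarrow> bool" where
  "morphism X Y \<phi> \<longleftrightarrow>
     (\<forall>x\<in>pts X. \<phi> x \<in> pts Y) \<and>
     (\<forall>U\<in>opens Y. {x \<in> pts X. \<phi> x \<in> U} \<in> opens X \<and>
        (\<forall>f\<in>reg Y U. (\<lambda>x. f (\<phi> x)) \<in> reg X {x \<in> pts X. \<phi> x \<in> U}))"

definition isomorphic :: "'p fun_space \<Rightarrow> 'q fun_space \<Rightarrow> bool" where
  "isomorphic X Y \<longleftrightarrow> (\<exists>\<phi> \<psi>. morphism X Y \<phi> \<and> morphism Y X \<psi> \<and>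
     (\<forall>x\<in>pts X. \<psi> (\<phi> x) = x) \<and> (\<forall>y\<in>pts Y. \<phi> (\<psi> y) = y))"


section \<open>Subvarieties of products of Grassmannians\<close>

definition grass :: "nat \<Rightarrow> ('x \<Rightarrow> complex) set \<Rightarrow> ('x \<Rightarrow> complex) set set" where
  "grass k U = {V. cvec.subspace V \<and> V \<subseteq> U \<and> cvec.dim V = k}"

definition frame_of ::
  "'v set \<Rightarrow> ('v \<Rightarrow> nat) \<Rightarrow> ('v \<Rightarrow> ('x \<Rightarrow> complex) set) \<Rightarrow> ('v \<Rightarrow> nat \<Rightarrow> 'x \<Rightarrow> complex) \<Rightarrow> bool" where
  "frame_of I e V b \<longleftrightarrow> (\<forall>i\<in>I. inj_on (b i) {..<e i} \<and>
     cvec.independent (b i ` {..<e i}) \<and> cvec.span (b i ` {..<e i}) = V i)"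

text \<open>
  The Pluecker coordinates of a \<open>k\<close>-dimensional space with basis \<open>b 0, \<dots>, b (k - 1)\<close> are the
  numbers \<open>det (\<phi> r (b c))\<close>, for linear forms \<open>\<phi> 0, \<dots>, \<phi> (k - 1)\<close>; letting these range over
  coordinate functions gives the usual maximal minors, and arbitrary linear forms give linear
  combinations of those.  \<open>mhom_form I e d p\<close> says that \<open>p\<close> is a multihomogeneous polynomial,
  of multidegree \<open>d\<close>, in the Pluecker coordinates of the factors of \<open>\<Prod>i\<in>I. Gr (e i)\<close>, written
  as a function of a choice of bases.
\<close>

inductive mhom_form ::
  "'v set \<Rightarrow> ('v \<Rightarrow> nat) \<Rightarrow> ('v \<Rightarrow> nat) \<Rightarrow> (('v \<Rightarrow> nat \<Rightarrow> 'x \<Rightarrow> complex) \<Rightarrow> complex) \<Rightarrow> bool"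
  for I :: "'v set" and e :: "'v \<Rightarrow> nat" where
  const: "mhom_form I e (\<lambda>_. 0) (\<lambda>_. c)"
| pluecker: "i \<in> I \<Longrightarrow> (\<And>r. r < e i \<Longrightarrow> Vector_Spaces.linear cscale (*) (\<phi> r)) \<Longrightarrow>
    mhom_form I e (\<lambda>j. if j = i then 1 else 0)
      (\<lambda>b. det (mat (e i) (e i) (\<lambda>(r, c). \<phi> r (b i c))))"
| add: "mhom_form I e d p \<Longrightarrow> mhom_form I e d q \<Longrightarrow> mhom_form I e d (\<lambda>b. p b + q b)"
| mult: "mhom_form I e d p \<Longrightarrow> mhom_form I e d' q \<Longrightarrow>
    mhom_form I e (\<lambda>j. d j + d' j) (\<lambda>b. p b * q b)"

text \<open>
  Passing to another basis of \<open>V i\<close> multiplies a multihomogeneous form by a nonzero scalar, so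
  whether it vanishes at \<open>V\<close>, and the value at \<open>V\<close> of a quotient of two forms of the same
  multidegree, do not depend on the bases.
\<close>

definition zariski_opens ::
  "'v set \<Rightarrow> ('v \<Rightarrow> nat) \<Rightarrow> ('v \<Rightarrow> ('x \<Rightarrow> complex) set) set \<Rightarrow> ('v \<Rightarrow> ('x \<Rightarrow> complex) set) set set" where
  "zariski_opens I e X = {U. \<exists>S. (\<forall>p\<in>S. \<exists>d. mhom_form I e d p) \<and>
     U = {V \<in> X. \<not> (\<forall>p\<in>S. \<forall>b. frame_of I e V b \<longrightarrow> p b = 0)}}"

definition regular_functions ::
  "'v set \<Rightarrow> ('v \<Rightarrow> nat) \<Rightarrow> ('v \<Rightarrow> ('x \<Rightarrow> complex) set) set \<Rightarrow> ('v \<Rightarrow> ('x \<Rightarrow> complex) set) set \<Rightarrow>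
    (('v \<Rightarrow> ('x \<Rightarrow> complex) set) \<Rightarrow> complex) set" where
  "regular_functions I e X U = {f. \<forall>V\<in>U. \<exists>N\<in>zariski_opens I e X. V \<in> N \<and> N \<subseteq> U \<and>
     (\<exists>d p q. mhom_form I e d p \<and> mhom_form I e d q \<and>
       (\<forall>V'\<in>N. \<forall>b. frame_of I e V' b \<longrightarrow> q b \<noteq> 0 \<and> f V' = p b / q b))}"

definition subvariety ::
  "'v set \<Rightarrow> ('v \<Rightarrow> nat) \<Rightarrow> ('v \<Rightarrow> ('x \<Rightarrow> complex) set) set \<Rightarrow> ('v \<Rightarrow> ('x \<Rightarrow> complex) set) fun_space" where
  "subvariety I e X =
     \<lparr>pts = X, opens = zariski_opens I e X, reg = regular_functions I e X\<rparr>"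


section \<open>Quivers, representations and quiver Grassmannians\<close>

record ('v, 'a) quiver =
  verts :: "'v set"
  arrows :: "'a set"
  src :: "'a \<Rightarrow> 'v"
  tgt :: "'a \<Rightarrow> 'v"

record ('v, 'a, 'x) rep =
  space :: "'v \<Rightarrow> ('x \<Rightarrow> complex) set"
  rmap :: "'a \<Rightarrow> ('x \<Rightarrow> complex) \<Rightarrow> ('x \<Rightarrow> complex)"

definition dim_vec_rep :: "('v, 'a, 'x) rep \<Rightarrow> 'v \<Rightarrow> nat" where
  "dim_vec_rep M i = cvec.dim (space M i)"

definition rep_sum :: "('v, 'a, 'x) rep \<Rightarrow> ('v, 'a, 'y) rep \<Rightarrow> ('v, 'a, 'x + 'y) rep" where
  "rep_sum M N =
     \<lparr>space = (\<lambda>i. {case_sum f g | f g. f \<in> space M i \<and> g \<in> space N i}),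
      rmap = (\<lambda>a h. case_sum (rmap M a (h \<circ> Inl)) (rmap N a (h \<circ> Inr)))\<rparr>"

definition quiver_grass_pts ::
  "('v, 'a) quiver \<Rightarrow> ('v \<Rightarrow> nat) \<Rightarrow> ('v, 'a, 'x) rep \<Rightarrow> ('v \<Rightarrow> ('x \<Rightarrow> complex) set) set" where
  "quiver_grass_pts Q e M =
     {V \<in> (\<Pi>\<^sub>E i\<in>verts Q. grass (e i) (space M i)).
        \<forall>a\<in>arrows Q. rmap M a ` V (src Q a) \<subseteq> V (tgt Q a)}"

definition quiver_grass ::
  "('v, 'a) quiver \<Rightarrow> ('v \<Rightarrow> nat) \<Rightarrow> ('v, 'a, 'x) rep \<Rightarrow> ('v \<Rightarrow> ('x \<Rightarrow> complex) set) fun_space" where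
  "quiver_grass Q e M = subvariety (verts Q) e (quiver_grass_pts Q e M)"


section \<open>The path algebra and its dual\<close>

text \<open>
  A path is its starting vertex together with the list of its arrows in the order in which they
  are traversed.
\<close>

type_synonym ('v, 'a) path = "'v \<times> 'a list"

fun is_walk :: "('v, 'a) quiver \<Rightarrow> 'v \<Rightarrow> 'a list \<Rightarrow> bool" where
  "is_walk Q v [] \<longleftrightarrow> v \<in> verts Q"
| "is_walk Q v (a # as) \<longleftrightarrow> v \<in> verts Q \<and> a \<in> arrows Q \<and> src Q a = v \<and> is_walk Q (tgt Q a) as"

fun walk_end :: "('v, 'a) quiver \<Rightarrow> 'v \<Rightarrow> 'a list \<Rightarrow> 'v" where
  "walk_end Q v [] = v"
| "walk_end Q v (a # as) = walk_end Q (tgt Q a) as"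

definition paths :: "('v, 'a) quiver \<Rightarrow> ('v, 'a) path set" where
  "paths Q = {(v, as). is_walk Q v as}"

definition path_source :: "('v, 'a) path \<Rightarrow> 'v" where
  "path_source p = fst p"

definition path_target :: "('v, 'a) quiver \<Rightarrow> ('v, 'a) path \<Rightarrow> 'v" where
  "path_target Q p = walk_end Q (fst p) (snd p)"

definition path_algebra :: "('v, 'a) quiver \<Rightarrow> (('v, 'a) path \<Rightarrow> complex) set" where
  "path_algebra Q = {x. finite {p. x p \<noteq> 0} \<and> {p. x p \<noteq> 0} \<subseteq> paths Q}"

text \<open>
  The product of two paths \<open>p q\<close> is "first \<open>q\<close>, then \<open>p\<close>", and zero if they do not compose; thus
  left modules are representations.
\<close>

definition pa_mult ::
  "('v, 'a) quiver \<Rightarrow> (('v, 'a) path \<Rightarrow> complex) \<Rightarrow> (('v, 'a) path \<Rightarrow> complex) \<Rightarrow> (('v, 'a) path \<Rightarrow> complex)" where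
  "pa_mult Q x y = (\<lambda>r. \<Sum>(p, q) \<in> {(p, q). p \<in> paths Q \<and> q \<in> paths Q \<and>
       path_source p = path_target Q q \<and> (path_source q, snd q @ snd p) = r}. x p * y q)"

definition path_elt :: "('v, 'a) path \<Rightarrow> ('v, 'a) path \<Rightarrow> complex" where
  "path_elt p = (\<lambda>r. if r = p then 1 else 0)"

text \<open>
  The representation attached to a left module \<open>M\<close> over the path algebra: \<open>e\<^sub>i M\<close> at the vertex
  \<open>i\<close>, where \<open>e\<^sub>i\<close> is the trivial path at \<open>i\<close>, and multiplication by \<open>a\<close> for an arrow \<open>a\<close>.
\<close>

definition rep_of_module ::
  "('v, 'a) quiver \<Rightarrow> ('x \<Rightarrow> complex) set \<Rightarrow>
    ((('v, 'a) path \<Rightarrow> complex) \<Rightarrow> ('x \<Rightarrow> complex) \<Rightarrow> ('x \<Rightarrow> complex)) \<Rightarrow> ('v, 'a, 'x) rep" where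
  "rep_of_module Q M act =
     \<lparr>space = (\<lambda>i. act (path_elt (i, [])) ` M),
      rmap = (\<lambda>a. act (path_elt (src Q a, [a])))\<rparr>"

definition path_algebra_rep :: "('v, 'a) quiver \<Rightarrow> ('v, 'a, ('v, 'a) path) rep" where
  "path_algebra_rep Q = rep_of_module Q (path_algebra Q) (pa_mult Q)"

text \<open>A linear form on \<open>U\<close> is extended by \<open>0\<close> outside \<open>U\<close>, to be determined by its values on \<open>U\<close>.\<close>

definition dual_space :: "('x \<Rightarrow> complex) set \<Rightarrow> (('x \<Rightarrow> complex) \<Rightarrow> complex) set" where
  "dual_space U = {F. (\<forall>x\<in>U. \<forall>y\<in>U. F (x + y) = F x + F y) \<and>
     (\<forall>c. \<forall>x\<in>U. F (cscale c x) = c * F x) \<and> (\<forall>x. x \<notin> U \<longrightarrow> F x = 0)}"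

text \<open>The dual of the right regular module is a left module by \<open>(a F) x = F (x a)\<close>.\<close>

definition dual_path_algebra_rep ::
  "('v, 'a) quiver \<Rightarrow> ('v, 'a, ('v, 'a) path \<Rightarrow> complex) rep" where
  "dual_path_algebra_rep Q = rep_of_module Q (dual_space (path_algebra Q))
     (\<lambda>a F x. if x \<in> path_algebra Q then F (pa_mult Q x a) else 0)"

text \<open>The arrow \<open>i \<rightarrow> i + 1\<close> is labelled \<open>i\<close>.\<close>

definition equioriented_A :: "nat \<Rightarrow> (nat, nat) quiver" where
  "equioriented_A n = \<lparr>verts = {1..n}, arrows = {1..<n}, src = (\<lambda>i. i), tgt = (\<lambda>i. i + 1)\<rparr>"


section \<open>The complete degenerate flag variety\<close>

definition is_basis_of :: "nat \<Rightarrow> (nat \<Rightarrow> 'x \<Rightarrow> complex) \<Rightarrow> ('x \<Rightarrow> complex) set \<Rightarrow> bool" where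
  "is_basis_of m w W \<longleftrightarrow> inj_on w {1..m} \<and> cvec.independent (w ` {1..m}) \<and> cvec.span (w ` {1..m}) = W"

definition pr :: "nat \<Rightarrow> (nat \<Rightarrow> 'x \<Rightarrow> complex) \<Rightarrow> nat \<Rightarrow> ('x \<Rightarrow> complex) \<Rightarrow> ('x \<Rightarrow> complex)" where
  "pr m w k v = (\<Sum>i\<in>{1..m} - {k}. cscale (cvec.representation (w ` {1..m}) v (w i)) (w i))"

definition degenerate_flag_pts ::
  "nat \<Rightarrow> (nat \<Rightarrow> 'x \<Rightarrow> complex) \<Rightarrow> ('x \<Rightarrow> complex) set \<Rightarrow> (nat \<Rightarrow> ('x \<Rightarrow> complex) set) set" where
  "degenerate_flag_pts n w W =
     {V \<in> (\<Pi>\<^sub>E i\<in>{1..n}. grass i W). \<forall>i\<in>{1..<n}. pr (n + 1) w (i + 1) ` V i \<subseteq> V (i + 1)}"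

definition degenerate_flag_variety ::
  "nat \<Rightarrow> (nat \<Rightarrow> 'x \<Rightarrow> complex) \<Rightarrow> ('x \<Rightarrow> complex) set \<Rightarrow> (nat \<Rightarrow> ('x \<Rightarrow> complex) set) fun_space" where
  "degenerate_flag_variety n w W = subvariety {1..n} (\<lambda>i. i) (degenerate_flag_pts n w W)"

end

theory Submission
  imports Defs
begin

text \<open>
  At the vertex \<open>i\<close> the representation \<open>A \<oplus> A*\<close> has a basis consisting of the paths
  \<open>k \<rightarrow> \<dots> \<rightarrow> i\<close> ending at \<open>i\<close>, for \<open>k \<le> i\<close>, and of the coordinate forms of the paths
  \<open>i \<rightarrow> \<dots> \<rightarrow> j\<close> starting at \<open>i\<close>, for \<open>j \<ge> i\<close>.  Number the former by \<open>k \<in> {1..i}\<close> and the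
  latter by \<open>k = j + 1 \<in> {i + 1..n + 1}\<close>, so that every vertex carries a basis indexed by
  \<open>{1..n + 1}\<close>.  The arrow \<open>i \<rightarrow> i + 1\<close> prolongs each path ending at \<open>i\<close>, and it turns the form
  of \<open>i \<rightarrow> \<dots> \<rightarrow> j\<close> into that of \<open>i + 1 \<rightarrow> \<dots> \<rightarrow> j\<close>, or into zero if \<open>j = i\<close>.  In both cases the
  number is preserved, and only the basis vector number \<open>i + 1\<close> is lost
  (\<open>regular_sum_rep_arrow\<close>).  This is precisely what \<open>pr\<^sub>i\<^sub>+\<^sub>1\<close> does to \<open>w\<^sub>1, \<dots>, w\<^sub>n\<^sub>+\<^sub>1\<close>
  (\<open>pr_lincomb\<close>).  Hence \<open>A \<oplus> A*\<close> is isomorphic to the representation with \<open>W\<close> at every vertex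
  and \<open>pr\<^sub>i\<^sub>+\<^sub>1\<close> at the arrow \<open>i \<rightarrow> i + 1\<close>, whose quiver Grassmannian for the dimension vector
  \<open>(1, \<dots>, n)\<close> is by definition the degenerate flag variety.  As \<open>i\<close> paths end at \<open>i\<close>, that
  dimension vector is the one of \<open>A\<close>.

  It remains that an isomorphism of representations induces an isomorphism of quiver
  Grassmannians as varieties (\<open>isomorphic_quiver_grass\<close>).  Linear isomorphisms \<open>T i\<close> carry
  subspaces to subspaces of the same dimension and bases to bases.  A Pluecker coordinate composed
  with them is again a Pluecker coordinate, since linear forms pull back to linear forms, and so
  multihomogeneous forms pull back to multihomogeneous forms of the same multidegree
  (\<open>mhom_form_pullback\<close>).  Consequently Zariski open sets and regular functions pull back as well
  (\<open>morphism_linear_image\<close>), and the same applies to the inverse maps.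
\<close>


section \<open>Linear algebra in function spaces\<close>

lemma cvec_pair: "vector_space_pair (cscale :: complex \<Rightarrow> ('x \<Rightarrow> complex) \<Rightarrow> _)
    (cscale :: complex \<Rightarrow> ('y \<Rightarrow> complex) \<Rightarrow> _)"
  by unfold_locales

lemma cscale_apply: "cscale c f x = c * f x"
  by (simp add: cscale_def)

lemma lincomb_apply: "(\<Sum>k\<in>K. cscale (c k) (u k)) x = (\<Sum>k\<in>K. c k * u k x)"
  by (induction K rule: infinite_finite_induct) (auto simp: cscale_def)

lemma linear_lincomb:
  assumes "Vector_Spaces.linear cscale cscale T"
  shows "T (\<Sum>k\<in>K. cscale (c k) (u k)) = (\<Sum>k\<in>K. cscale (c k) (T (u k)))"
proof -
  interpret T: Vector_Spaces.linear cscale cscale T by fact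
  show ?thesis by (simp add: T.sum T.scale)
qed

lemma basis_space_eq_lincombs:
  assumes "is_basis_of m w W"
  shows "W = range (\<lambda>c. \<Sum>k\<in>{1..m}. cscale (c k) (w k))"
proof -
  have inj: "inj_on w {1..m}" and W: "cvec.span (w ` {1..m}) = W"
    using assms by (auto simp: is_basis_of_def)
  have "W = range (\<lambda>u. \<Sum>v\<in>w ` {1..m}. cscale (u v) v)"
    using W cvec.span_finite[of "w ` {1..m}"] by simp
  also have "\<dots> = range (\<lambda>c. \<Sum>k\<in>{1..m}. cscale (c k) (w k))"
  proof (intro equalityI image_subsetI)
    fix u show "(\<Sum>v\<in>w ` {1..m}. cscale (u v) v) \<in> range (\<lambda>c. \<Sum>k\<in>{1..m}. cscale (c k) (w k))"
      by (rule range_eqI[of _ _ "\<lambda>k. u (w k)"]) (simp add: sum.reindex[OF inj] del: One_nat_def)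
  next
    fix c show "(\<Sum>k\<in>{1..m}. cscale (c k) (w k)) \<in> range (\<lambda>u. \<Sum>v\<in>w ` {1..m}. cscale (u v) v)"
      by (rule range_eqI[of _ _ "\<lambda>v. c (the_inv_into {1..m} w v)"])
        (simp add: sum.reindex[OF inj] the_inv_into_f_f[OF inj] del: One_nat_def)
  qed
  finally show ?thesis .
qed

text \<open>
  The map is linear on the whole function space and not just on \<open>V\<close>: linear forms on the target
  are to be composed with it, and the forms entering Pluecker coordinates are defined everywhere.
\<close>

lemma basis_transfer_linear:
  assumes "is_basis_of m v V"
  obtains T where "Vector_Spaces.linear cscale cscale T" "\<And>k. k \<in> {1..m} \<Longrightarrow> T (v k) = w k"
proof -
  have inj: "inj_on v {1..m}" and ind: "cvec.independent (v ` {1..m})"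
    using assms by (auto simp: is_basis_of_def)
  obtain T where "Vector_Spaces.linear cscale cscale T"
    "\<forall>x\<in>v ` {1..m}. T x = w (the_inv_into {1..m} v x)"
    using vector_space_pair.linear_independent_extend[OF cvec_pair ind,
        of "\<lambda>x. w (the_inv_into {1..m} v x)"] by blast
  then show ?thesis using that by (simp add: the_inv_into_f_f[OF inj] del: One_nat_def)
qed

text \<open>
  Evaluations at points are linear forms on a function space; when they form a dual system to the
  functions \<open>w k\<close>, the latter are independent.  All bases of concrete spaces below are of this
  kind.
\<close>

lemma is_basis_of_if_dual_points:
  assumes dual: "\<And>k l. k \<in> {1..m} \<Longrightarrow> l \<in> {1..m} \<Longrightarrow> w k (x l) = (if k = l then 1 else 0)"
    and W: "W = range (\<lambda>c. \<Sum>k\<in>{1..m}. cscale (c k) (w k))"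
  shows "is_basis_of m w W"
proof -
  have inj: "inj_on w {1..m}"
    by (rule inj_onI) (metis dual zero_neq_one)
  have "cvec.independent (w ` {1..m})"
  proof -
    have "u (w l) = 0"
      if s: "(\<Sum>v\<in>w ` {1..m}. cscale (u v) v) = 0" and l: "l \<in> {1..m}" for u l
    proof -
      have "0 = (\<Sum>k\<in>{1..m}. cscale (u (w k)) (w k)) (x l)"
        using s by (simp add: sum.reindex[OF inj] del: One_nat_def)
      also have "\<dots> = (\<Sum>k\<in>{1..m}. u (w k) * w k (x l))"
        by (rule lincomb_apply)
      also have "\<dots> = (\<Sum>k\<in>{1..m}. if k = l then u (w k) else 0)"
        by (rule sum.cong) (use dual l in auto)
      also have "\<dots> = u (w l)" using l by simp
      finally show ?thesis by simp
    qed
    then show ?thesis by (subst cvec.dependent_finite) auto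
  qed
  moreover have "cvec.span (w ` {1..m}) = W"
  proof -
    have "is_basis_of m w (cvec.span (w ` {1..m}))"
      using inj \<open>cvec.independent _\<close> by (simp add: is_basis_of_def)
    then show ?thesis using basis_space_eq_lincombs W by blast
  qed
  ultimately show ?thesis using inj by (simp add: is_basis_of_def)
qed

lemma is_basis_of_dim: "is_basis_of m w W \<Longrightarrow> cvec.dim W = m"
  unfolding is_basis_of_def
  by (metis card_atLeastAtMost card_image cvec.dim_span_eq_card_independent diff_Suc_1)

lemma pr_lincomb:
  assumes w: "is_basis_of m w W"
  shows "pr m w z (\<Sum>k\<in>{1..m}. cscale (c k) (w k)) = (\<Sum>k\<in>{1..m} - {z}. cscale (c k) (w k))"
proof -
  have inj: "inj_on w {1..m}" and ind: "cvec.independent (w ` {1..m})"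
    using w by (auto simp: is_basis_of_def)
  have "cvec.representation (w ` {1..m}) (\<Sum>k\<in>{1..m}. cscale (c k) (w k)) (w l) = c l"
    if l: "l \<in> {1..m}" for l
  proof -
    have "cvec.representation (w ` {1..m}) (\<Sum>k\<in>{1..m}. cscale (c k) (w k)) (w l)
        = (\<Sum>k\<in>{1..m}. c k * cvec.representation (w ` {1..m}) (w k) (w l))"
      by (subst cvec.representation_sum[OF ind])
        (simp_all add: cvec.representation_scale[OF ind] cvec.span_base cvec.span_scale del: One_nat_def)
    also have "\<dots> = (\<Sum>k\<in>{1..m}. if k = l then c k else 0)"
      using l by (intro sum.cong) (auto simp: cvec.representation_basis[OF ind] inj_on_eq_iff[OF inj] simp del: One_nat_def)
    also have "\<dots> = c l" using l by simp
    finally show ?thesis .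
  qed
  then show ?thesis unfolding pr_def by (intro sum.cong) auto
qed

lemma grass_linear_image:
  assumes T: "Vector_Spaces.linear cscale cscale T"
    and inv: "\<And>v. v \<in> M \<Longrightarrow> S (T v) = v" and MN: "T ` M \<subseteq> N"
    and V: "V \<in> grass k M"
  shows "T ` V \<in> grass k N"
proof -
  interpret vector_space_pair cscale cscale by (rule cvec_pair)
  interpret T: Vector_Spaces.linear cscale cscale T by fact
  have sub: "cvec.subspace V" and VM: "V \<subseteq> M" and d: "cvec.dim V = k"
    using V by (auto simp: grass_def)
  obtain B where B: "B \<subseteq> V" "cvec.independent B" "V \<subseteq> cvec.span B" "card B = k"
    using cvec.basis_exists[of V] d by metis
  have sp: "cvec.span B = V"
    using B sub by (simp add: cvec.span_minimal subset_antisym)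
  have inj: "inj_on T V"
    using inv VM by (metis inj_on_inverseI subsetD)
  have "cvec.dim (T ` V) = card (T ` B)"
    using B sp inj by (metis T.span_image T.independent_injective_image cvec.dim_span_eq_card_independent)
  also have "\<dots> = k" using B inj by (metis card_image inj_on_subset)
  finally show ?thesis
    using sub VM MN by (auto simp: grass_def T.subspace_image)
qed


section \<open>Linear changes of coordinates on products of Grassmannians\<close>

text \<open>
  A choice of bases is a total function, while only its values at the vertices and below the
  dimensions matter.  This is needed because transporting a frame there and back restores only
  those values.
\<close>

lemma mhom_form_cong:
  assumes "mhom_form I e d p" and "\<And>i c. i \<in> I \<Longrightarrow> c < e i \<Longrightarrow> b i c = b' i c"
  shows "p b = p b'"
  using assms(1)
proof induction
  case (pluecker i \<phi>)
  then have "mat (e i) (e i) (\<lambda>(r, c). \<phi> r (b i c)) = mat (e i) (e i) (\<lambda>(r, c). \<phi> r (b' i c))"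
    using assms(2) by (intro eq_matI) auto
  then show ?case by simp
qed auto

text \<open>
  By induction on the form: for a Pluecker coordinate, the linear forms \<open>\<phi> r\<close> are replaced by
  \<open>\<phi> r \<circ> T i\<close>.
\<close>

lemma mhom_form_pullback:
  assumes "mhom_form I e' d p" and e: "\<And>i. i \<in> I \<Longrightarrow> e i = e' i"
    and T: "\<And>i. i \<in> I \<Longrightarrow> Vector_Spaces.linear cscale cscale (T i)"
  shows "mhom_form I e d (\<lambda>b. p (\<lambda>i c. T i (b i c)))"
  using assms(1)
proof induction
  case (const c)
  show ?case by (rule mhom_form.const)
next
  case (pluecker i \<phi>)
  have "Vector_Spaces.linear cscale (*) (\<lambda>v. \<phi> r (T i v))" if "r < e i" for r
    using Vector_Spaces.linear_compose[OF T[OF pluecker(1)] pluecker(2)[of r]] that e pluecker(1)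
    by (simp add: comp_def)
  from mhom_form.pluecker[of i I e "\<lambda>r v. \<phi> r (T i v)", OF pluecker(1) this]
  show ?case using e[OF pluecker(1)] by simp
next
  case add
  then show ?case by (intro mhom_form.add)
next
  case mult
  then show ?case by (intro mhom_form.mult)
qed

lemma frame_of_linear_image:
  assumes "frame_of I e V b" and e: "\<And>i. i \<in> I \<Longrightarrow> e i = e' i"
    and T: "\<And>i. i \<in> I \<Longrightarrow> Vector_Spaces.linear cscale cscale (T i)"
    and inv: "\<And>i v. i \<in> I \<Longrightarrow> v \<in> V i \<Longrightarrow> S i (T i v) = v"
  shows "frame_of I e' (\<lambda>i\<in>I. T i ` V i) (\<lambda>i c. T i (b i c))"
  unfolding frame_of_def
proof (intro ballI)
  fix i assume i: "i \<in> I"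
  interpret vector_space_pair cscale cscale by (rule cvec_pair)
  interpret T: Vector_Spaces.linear cscale cscale "T i" using T[OF i] .
  have b: "inj_on (b i) {..<e' i}" "cvec.independent (b i ` {..<e' i})"
    "cvec.span (b i ` {..<e' i}) = V i"
    using assms(1) i e by (auto simp: frame_of_def)
  have inj: "inj_on (T i) (V i)"
    using inv i by (metis inj_on_inverseI)
  have sub: "b i ` {..<e' i} \<subseteq> V i" using cvec.span_superset[of "b i ` {..<e' i}"] by (simp only: b(3))
  have img: "(\<lambda>c. T i (b i c)) ` {..<e' i} = T i ` b i ` {..<e' i}" by auto
  have "inj_on (\<lambda>c. T i (b i c)) {..<e' i}"
    using comp_inj_on[OF b(1) inj_on_subset[OF inj sub]] by (simp add: comp_def)
  moreover have "cvec.independent (T i ` b i ` {..<e' i})"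
    using b inj by (intro T.independent_injective_image) auto
  moreover have "cvec.span (T i ` b i ` {..<e' i}) = T i ` V i"
    using b(3) by (metis T.span_image)
  ultimately show "inj_on (\<lambda>c. T i (b i c)) {..<e' i} \<and>
      cvec.independent ((\<lambda>c. T i (b i c)) ` {..<e' i}) \<and>
      cvec.span ((\<lambda>c. T i (b i c)) ` {..<e' i}) = (\<lambda>i\<in>I. T i ` V i) i"
    using i img by simp
qed

text \<open>
  A form \<open>p\<close> vanishes on the frames of the image of \<open>V\<close> if and only if its pullback vanishes on
  the frames of \<open>V\<close>, because every frame of the image is the image of a frame of \<open>V\<close>, obtained
  with the inverse maps \<open>S i\<close>.  This gives continuity.  Regular functions are quotients of forms
  on small open sets, and numerator and denominator are pulled back separately.
\<close>

lemma morphism_linear_image: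
  fixes T :: "'v \<Rightarrow> ('x \<Rightarrow> complex) \<Rightarrow> ('y \<Rightarrow> complex)"
  assumes e: "\<And>i. i \<in> I \<Longrightarrow> e i = e' i"
    and T: "\<And>i. i \<in> I \<Longrightarrow> Vector_Spaces.linear cscale cscale (T i)"
    and S: "\<And>i. i \<in> I \<Longrightarrow> Vector_Spaces.linear cscale cscale (S i)"
    and inv: "\<And>V i v. V \<in> X \<Longrightarrow> i \<in> I \<Longrightarrow> v \<in> V i \<Longrightarrow> S i (T i v) = v"
    and XY: "\<And>V. V \<in> X \<Longrightarrow> (\<lambda>i\<in>I. T i ` V i) \<in> Y"
  shows "morphism (subvariety I e X) (subvariety I e' Y) (\<lambda>V. \<lambda>i\<in>I. T i ` V i)"
proof -
  define \<phi> where "\<phi> = (\<lambda>V. \<lambda>i\<in>I. T i ` V i)"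
  define pull :: "(('v \<Rightarrow> nat \<Rightarrow> 'y \<Rightarrow> complex) \<Rightarrow> complex) \<Rightarrow> ('v \<Rightarrow> nat \<Rightarrow> 'x \<Rightarrow> complex) \<Rightarrow> complex"
    where "pull p = (\<lambda>b. p (\<lambda>i c. T i (b i c)))" for p
  have pull: "mhom_form I e d (pull p)" if "mhom_form I e' d p" for d p
    unfolding pull_def by (rule mhom_form_pullback[OF that e T])
  have frame: "frame_of I e' (\<phi> V) (\<lambda>i c. T i (b i c))" if "V \<in> X" "frame_of I e V b" for V b
    unfolding \<phi>_def by (rule frame_of_linear_image[where T = T, OF that(2) e T inv[OF that(1)]])
  have vanish: "(\<forall>b. frame_of I e' (\<phi> V) b \<longrightarrow> p b = 0) \<longleftrightarrow> (\<forall>b. frame_of I e V b \<longrightarrow> pull p b = 0)"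
    if V: "V \<in> X" and p: "mhom_form I e' d p" for V d p
  proof
    assume "\<forall>b. frame_of I e' (\<phi> V) b \<longrightarrow> p b = 0"
    then show "\<forall>b. frame_of I e V b \<longrightarrow> pull p b = 0"
      using frame[OF V] by (simp add: pull_def)
  next
    assume R: "\<forall>b. frame_of I e V b \<longrightarrow> pull p b = 0"
    show "\<forall>b. frame_of I e' (\<phi> V) b \<longrightarrow> p b = 0"
    proof (intro allI impI)
      fix b assume b: "frame_of I e' (\<phi> V) b"
      \<comment> \<open>Transport the frame back to \<open>V\<close>, where the pullback of \<open>p\<close> is known to vanish.\<close>
      have TS: "T i (S i u) = u" if "i \<in> I" "u \<in> \<phi> V i" for i u
        using that inv[OF V] by (auto simp: \<phi>_def)
      have "frame_of I e (\<lambda>i\<in>I. S i ` \<phi> V i) (\<lambda>i c. S i (b i c))"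
        by (rule frame_of_linear_image[where T = S, OF b e[symmetric] S TS])
      moreover have "S i ` \<phi> V i = V i" if "i \<in> I" for i
        using that inv[OF V] by (force simp: \<phi>_def image_image)
      ultimately have "frame_of I e V (\<lambda>i c. S i (b i c))"
        by (simp add: frame_of_def)
      then have "pull p (\<lambda>i c. S i (b i c)) = 0" using R by blast
      moreover have "p (\<lambda>i c. T i (S i (b i c))) = p b"
      proof (rule mhom_form_cong[OF p])
        fix i c assume i: "i \<in> I" "c < e' i"
        then have "b i c \<in> \<phi> V i"
          using b cvec.span_base[of "b i c" "b i ` {..<e' i}"] by (simp add: frame_of_def)
        then show "T i (S i (b i c)) = b i c" by (rule TS[OF i(1)])
      qed
      ultimately show "p b = 0" by (simp add: pull_def)
    qed
  qed
  have opens: "{V \<in> X. \<phi> V \<in> U} \<in> zariski_opens I e X" if U: "U \<in> zariski_opens I e' Y" for U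
  proof -
    obtain F where F: "\<forall>p\<in>F. \<exists>d. mhom_form I e' d p"
      and U: "U = {V \<in> Y. \<not> (\<forall>p\<in>F. \<forall>b. frame_of I e' V b \<longrightarrow> p b = 0)}"
      using U[unfolded zariski_opens_def mem_Collect_eq] by (elim exE conjE) (rule that)
    have "{V \<in> X. \<phi> V \<in> U} = {V \<in> X. \<not> (\<forall>p\<in>pull ` F. \<forall>b. frame_of I e V b \<longrightarrow> p b = 0)}"
    proof (rule Collect_cong, rule conj_cong[OF refl])
      fix V assume V: "V \<in> X"
      have "(\<forall>p\<in>F. \<forall>b. frame_of I e' (\<phi> V) b \<longrightarrow> p b = 0) \<longleftrightarrow>
          (\<forall>p\<in>F. \<forall>b. frame_of I e V b \<longrightarrow> pull p b = 0)"
        using F vanish[OF V] by (intro ball_cong refl) blast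
      moreover have "\<phi> V \<in> Y" using XY[OF V] by (simp only: \<phi>_def)
      ultimately show "\<phi> V \<in> U \<longleftrightarrow> \<not> (\<forall>p\<in>pull ` F. \<forall>b. frame_of I e V b \<longrightarrow> p b = 0)"
        unfolding U by (simp only: mem_Collect_eq simp_thms ball_simps(9))
    qed
    moreover have "\<forall>p\<in>pull ` F. \<exists>d. mhom_form I e d p"
    proof
      fix p' assume "p' \<in> pull ` F"
      then obtain p where "p \<in> F" and p': "p' = pull p" by (rule imageE)
      then obtain d where "mhom_form I e' d p" using F by (elim ballE exE) auto
      then show "\<exists>d. mhom_form I e d p'" unfolding p' by (intro exI) (rule pull)
    qed
    ultimately show ?thesis
      unfolding zariski_opens_def mem_Collect_eq by (intro exI[of _ "pull ` F"] conjI)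
  qed
  have regular: "(\<lambda>V. f (\<phi> V)) \<in> regular_functions I e X {V \<in> X. \<phi> V \<in> U}"
    if f: "f \<in> regular_functions I e' Y U" for f U
    unfolding regular_functions_def
  proof (intro CollectI ballI)
    fix V assume V: "V \<in> {V \<in> X. \<phi> V \<in> U}"
    have "\<exists>N\<in>zariski_opens I e' Y. \<phi> V \<in> N \<and> N \<subseteq> U \<and>
        (\<exists>d p q. mhom_form I e' d p \<and> mhom_form I e' d q \<and>
          (\<forall>V'\<in>N. \<forall>b. frame_of I e' V' b \<longrightarrow> q b \<noteq> 0 \<and> f V' = p b / q b))"
      using f V unfolding regular_functions_def mem_Collect_eq by (elim conjE) (erule bspec)
    then obtain N d p q where N: "N \<in> zariski_opens I e' Y" "\<phi> V \<in> N" "N \<subseteq> U"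
      and pq: "mhom_form I e' d p" "mhom_form I e' d q"
      and quot: "\<forall>V'\<in>N. \<forall>b. frame_of I e' V' b \<longrightarrow> q b \<noteq> 0 \<and> f V' = p b / q b"
      by (elim bexE exE conjE) (rule that)
    have "\<forall>V'\<in>{V \<in> X. \<phi> V \<in> N}. \<forall>b. frame_of I e V' b \<longrightarrow>
        pull q b \<noteq> 0 \<and> f (\<phi> V') = pull p b / pull q b"
      using quot frame by (auto simp: pull_def)
    moreover have "V \<in> {V \<in> X. \<phi> V \<in> N}" "{V \<in> X. \<phi> V \<in> N} \<subseteq> {V \<in> X. \<phi> V \<in> U}"
      using V N(2,3) by auto
    ultimately show "\<exists>N\<in>zariski_opens I e X. V \<in> N \<and> N \<subseteq> {V \<in> X. \<phi> V \<in> U} \<and>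
        (\<exists>d p q. mhom_form I e d p \<and> mhom_form I e d q \<and>
          (\<forall>V'\<in>N. \<forall>b. frame_of I e V' b \<longrightarrow> q b \<noteq> 0 \<and> f (\<phi> V') = p b / q b))"
      using opens[OF N(1)] pull[OF pq(1)] pull[OF pq(2)]
      by (intro bexI[of _ "{V \<in> X. \<phi> V \<in> N}"] conjI exI[of _ d] exI[of _ "pull p"]
          exI[of _ "pull q"])
  qed
  show ?thesis
    unfolding \<phi>_def[symmetric] morphism_def subvariety_def fun_space.simps
    using XY[folded \<phi>_def] opens regular by (intro conjI ballI) (simp_all only: \<phi>_def)
qed


section \<open>Isomorphic representations have isomorphic quiver Grassmannians\<close>

lemma quiver_grass_pts_linear_image:
  assumes Q: "\<And>a. a \<in> arrows Q \<Longrightarrow> src Q a \<in> verts Q \<and> tgt Q a \<in> verts Q"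
    and e: "\<And>i. i \<in> verts Q \<Longrightarrow> e i = e' i"
    and T: "\<And>i. i \<in> verts Q \<Longrightarrow> Vector_Spaces.linear cscale cscale (T i)"
    and inv: "\<And>i v. i \<in> verts Q \<Longrightarrow> v \<in> space M i \<Longrightarrow> S i (T i v) = v"
    and MN: "\<And>i. i \<in> verts Q \<Longrightarrow> T i ` space M i \<subseteq> space N i"
    and comm: "\<And>a v. a \<in> arrows Q \<Longrightarrow> v \<in> space M (src Q a) \<Longrightarrow>
        rmap N a (T (src Q a) v) = T (tgt Q a) (rmap M a v)"
    and V: "V \<in> quiver_grass_pts Q e M"
  shows "(\<lambda>i\<in>verts Q. T i ` V i) \<in> quiver_grass_pts Q e' N"
proof -
  have gr: "V i \<in> grass (e i) (space M i)" if "i \<in> verts Q" for i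
    using V that by (auto simp: quiver_grass_pts_def)
  have "T i ` V i \<in> grass (e' i) (space N i)" if "i \<in> verts Q" for i
    using grass_linear_image[OF T inv MN gr] that e by auto
  moreover have "rmap N a ` T (src Q a) ` V (src Q a) \<subseteq> T (tgt Q a) ` V (tgt Q a)"
    if a: "a \<in> arrows Q" for a
  proof -
    have "V (src Q a) \<subseteq> space M (src Q a)"
      using gr Q[OF a] by (auto simp: grass_def)
    moreover have "rmap M a ` V (src Q a) \<subseteq> V (tgt Q a)"
      using V a by (auto simp: quiver_grass_pts_def)
    ultimately show ?thesis using comm[OF a] by auto
  qed
  ultimately show ?thesis using Q by (simp add: quiver_grass_pts_def)
qed

proposition isomorphic_quiver_grass:
  assumes Q: "\<And>a. a \<in> arrows Q \<Longrightarrow> src Q a \<in> verts Q \<and> tgt Q a \<in> verts Q"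
    and e: "\<And>i. i \<in> verts Q \<Longrightarrow> e i = e' i"
    and T: "\<And>i. i \<in> verts Q \<Longrightarrow> Vector_Spaces.linear cscale cscale (T i)"
    and S: "\<And>i. i \<in> verts Q \<Longrightarrow> Vector_Spaces.linear cscale cscale (S i)"
    and ST: "\<And>i v. i \<in> verts Q \<Longrightarrow> v \<in> space M i \<Longrightarrow> S i (T i v) = v"
    and TS: "\<And>i v. i \<in> verts Q \<Longrightarrow> v \<in> space N i \<Longrightarrow> T i (S i v) = v"
    and MN: "\<And>i. i \<in> verts Q \<Longrightarrow> T i ` space M i \<subseteq> space N i"
    and NM: "\<And>i. i \<in> verts Q \<Longrightarrow> S i ` space N i \<subseteq> space M i"
    and comm: "\<And>a v. a \<in> arrows Q \<Longrightarrow> v \<in> space M (src Q a) \<Longrightarrow>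
        rmap M a v \<in> space M (tgt Q a) \<and> rmap N a (T (src Q a) v) = T (tgt Q a) (rmap M a v)"
  shows "isomorphic (quiver_grass Q e M) (quiver_grass Q e' N)"
proof -
  define X where "X = quiver_grass_pts Q e M"
  define Y where "Y = quiver_grass_pts Q e' N"
  \<comment> \<open>The inverse of an intertwining map is intertwining, which makes the situation symmetric.\<close>
  have comm': "rmap M a (S (src Q a) u) = S (tgt Q a) (rmap N a u)"
    if "a \<in> arrows Q" "u \<in> space N (src Q a)" for a u
  proof -
    have v: "S (src Q a) u \<in> space M (src Q a)" using NM Q that by blast
    from comm[OF that(1) v] show ?thesis using Q ST TS that by metis
  qed
  have XY: "(\<lambda>i\<in>verts Q. T i ` V i) \<in> Y" if "V \<in> X" for V
    unfolding Y_def
    by (rule quiver_grass_pts_linear_image[where S = S and e = e and M = M])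
      (use Q e T ST MN comm that[unfolded X_def] in blast)+
  have YX: "(\<lambda>i\<in>verts Q. S i ` V i) \<in> X" if "V \<in> Y" for V
    unfolding X_def
    by (rule quiver_grass_pts_linear_image[where S = T and e = e' and M = N])
      (use Q e[symmetric] S TS NM comm' that[unfolded Y_def] in blast)+
  have XM: "V i \<subseteq> space M i" if "V \<in> X" "i \<in> verts Q" for V i
    using that by (auto simp: X_def quiver_grass_pts_def grass_def PiE_iff)
  have YN: "V i \<subseteq> space N i" if "V \<in> Y" "i \<in> verts Q" for V i
    using that by (auto simp: Y_def quiver_grass_pts_def grass_def PiE_iff)
  let ?\<phi> = "\<lambda>V. \<lambda>i\<in>verts Q. T i ` V i" and ?\<psi> = "\<lambda>V. \<lambda>i\<in>verts Q. S i ` V i"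
  have "morphism (subvariety (verts Q) e X) (subvariety (verts Q) e' Y) ?\<phi>"
    by (rule morphism_linear_image[where S = S]) (use e T S XY ST XM in blast)+
  moreover have "morphism (subvariety (verts Q) e' Y) (subvariety (verts Q) e X) ?\<psi>"
    by (rule morphism_linear_image[where S = T]) (use e[symmetric] T S YX TS YN in blast)+
  moreover have "?\<psi> (?\<phi> V) = V" if V: "V \<in> X" for V
  proof
    fix i show "?\<psi> (?\<phi> V) i = V i"
    proof (cases "i \<in> verts Q")
      case True
      then show ?thesis using ST XM[OF V True] by (force simp: image_image)
    next
      case False
      then show ?thesis using V by (auto simp: X_def quiver_grass_pts_def)
    qed
  qed
  moreover have "?\<phi> (?\<psi> V) = V" if V: "V \<in> Y" for V
  proof
    fix i show "?\<phi> (?\<psi> V) i = V i"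
    proof (cases "i \<in> verts Q")
      case True
      then show ?thesis using TS YN[OF V True] by (force simp: image_image)
    next
      case False
      then show ?thesis using V by (auto simp: Y_def quiver_grass_pts_def)
    qed
  qed
  ultimately show ?thesis
    unfolding isomorphic_def quiver_grass_def X_def[symmetric] Y_def[symmetric]
    by (intro exI[of _ ?\<phi>] exI[of _ ?\<psi>]) (auto simp: subvariety_def)
qed

text \<open>
  Two representations are isomorphic as soon as their arrows have the same matrices.  Here the
  matrices are those of coordinate projections, with \<open>Z a\<close> the indices of the basis vectors
  killed by \<open>a\<close>.
\<close>

proposition isomorphic_quiver_grass_if_matching_bases:
  assumes Q: "\<And>a. a \<in> arrows Q \<Longrightarrow> src Q a \<in> verts Q \<and> tgt Q a \<in> verts Q"
    and e: "\<And>i. i \<in> verts Q \<Longrightarrow> e i = e' i"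
    and \<beta>: "\<And>i. i \<in> verts Q \<Longrightarrow> is_basis_of m (\<beta> i) (space M i)"
    and \<gamma>: "\<And>i. i \<in> verts Q \<Longrightarrow> is_basis_of m (\<gamma> i) (space N i)"
    and M: "\<And>a c. a \<in> arrows Q \<Longrightarrow> rmap M a (\<Sum>k\<in>{1..m}. cscale (c k) (\<beta> (src Q a) k))
        = (\<Sum>k\<in>{1..m} - Z a. cscale (c k) (\<beta> (tgt Q a) k))"
    and N: "\<And>a c. a \<in> arrows Q \<Longrightarrow> rmap N a (\<Sum>k\<in>{1..m}. cscale (c k) (\<gamma> (src Q a) k))
        = (\<Sum>k\<in>{1..m} - Z a. cscale (c k) (\<gamma> (tgt Q a) k))"
  shows "isomorphic (quiver_grass Q e M) (quiver_grass Q e' N)"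
proof -
  have "\<exists>T. \<forall>i\<in>verts Q. Vector_Spaces.linear cscale cscale (T i) \<and> (\<forall>k\<in>{1..m}. T i (\<beta> i k) = \<gamma> i k)"
    by (rule bchoice) (metis \<beta> basis_transfer_linear)
  then obtain T where T: "\<And>i. i \<in> verts Q \<Longrightarrow> Vector_Spaces.linear cscale cscale (T i)"
    and T\<beta>: "\<And>i k. i \<in> verts Q \<Longrightarrow> k \<in> {1..m} \<Longrightarrow> T i (\<beta> i k) = \<gamma> i k" by blast
  have "\<exists>S. \<forall>i\<in>verts Q. Vector_Spaces.linear cscale cscale (S i) \<and> (\<forall>k\<in>{1..m}. S i (\<gamma> i k) = \<beta> i k)"
    by (rule bchoice) (metis \<gamma> basis_transfer_linear)
  then obtain S where S: "\<And>i. i \<in> verts Q \<Longrightarrow> Vector_Spaces.linear cscale cscale (S i)"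
    and S\<gamma>: "\<And>i k. i \<in> verts Q \<Longrightarrow> k \<in> {1..m} \<Longrightarrow> S i (\<gamma> i k) = \<beta> i k" by blast
  have sM: "space M i = range (\<lambda>c. \<Sum>k\<in>{1..m}. cscale (c k) (\<beta> i k))" if "i \<in> verts Q" for i
    using basis_space_eq_lincombs[OF \<beta>[OF that]] .
  have sN: "space N i = range (\<lambda>c. \<Sum>k\<in>{1..m}. cscale (c k) (\<gamma> i k))" if "i \<in> verts Q" for i
    using basis_space_eq_lincombs[OF \<gamma>[OF that]] .
  have Tc: "T i (\<Sum>k\<in>K. cscale (c k) (\<beta> i k)) = (\<Sum>k\<in>K. cscale (c k) (\<gamma> i k))"
    if "i \<in> verts Q" "K \<subseteq> {1..m}" for i c K
    using that T\<beta> by (subst linear_lincomb[OF T]) (auto intro!: sum.cong simp: subset_iff)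
  have Sc: "S i (\<Sum>k\<in>K. cscale (c k) (\<gamma> i k)) = (\<Sum>k\<in>K. cscale (c k) (\<beta> i k))"
    if "i \<in> verts Q" "K \<subseteq> {1..m}" for i c K
    using that S\<gamma> by (subst linear_lincomb[OF S]) (auto intro!: sum.cong simp: subset_iff)
  have part: "(\<Sum>k\<in>K. cscale (c k) (\<beta> i k)) \<in> space M i"
    if "i \<in> verts Q" "K \<subseteq> {1..m}" for i K c
  proof -
    have "cvec.span (\<beta> i ` {1..m}) = space M i"
      using \<beta>[OF that(1)] by (simp add: is_basis_of_def)
    moreover have "(\<Sum>k\<in>K. cscale (c k) (\<beta> i k)) \<in> cvec.span (\<beta> i ` {1..m})"
      by (intro cvec.span_sum cvec.span_scale cvec.span_base imageI subsetD[OF that(2)])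
    ultimately show ?thesis by (simp only:)
  qed
  show ?thesis
  proof (rule isomorphic_quiver_grass[of Q e e' T S M N])
    fix a v assume a: "a \<in> arrows Q" and v: "v \<in> space M (src Q a)"
    then obtain c where c: "v = (\<Sum>k\<in>{1..m}. cscale (c k) (\<beta> (src Q a) k))"
      using sM Q by blast
    show "rmap M a v \<in> space M (tgt Q a) \<and> rmap N a (T (src Q a) v) = T (tgt Q a) (rmap M a v)"
      using Q[OF a] a part by (simp add: c M N Tc del: One_nat_def)
  qed (use Q e T S in \<open>auto simp: sM sN Tc Sc\<close>)
qed


section \<open>The path algebra of the equioriented quiver and its dual\<close>

text \<open>
  Between two vertices \<open>i \<le> j\<close> there is exactly one path.  For \<open>j < i\<close> the value of \<open>stretch\<close> is
  the trivial path at \<open>i\<close>, so \<open>j\<close> can be recovered from the path only if \<open>i \<le> j\<close>.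
\<close>

definition stretch :: "nat \<Rightarrow> nat \<Rightarrow> (nat, nat) path" where
  "stretch i j = (i, [i..<j])"

lemma stretch_refl: "stretch i i = (i, [])"
  by (simp add: stretch_def)

lemma stretch_Suc: "stretch i (i + 1) = (i, [i])"
  by (simp add: stretch_def)

lemma stretch_eq_iff: "i \<le> j \<Longrightarrow> i' \<le> j' \<Longrightarrow> stretch i j = stretch i' j' \<longleftrightarrow> i = i' \<and> j = j'"
  by (auto simp: stretch_def dest!: arg_cong[of _ _ length])

lemma src_equioriented_A: "src (equioriented_A n) i = i"
  by (simp add: equioriented_A_def)

lemma is_walk_equioriented_A:
  "is_walk (equioriented_A n) v as \<longleftrightarrow> 1 \<le> v \<and> v + length as \<le> n \<and> as = [v..<v + length as]"
proof (induction as arbitrary: v)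
  case Nil
  then show ?case by (auto simp: equioriented_A_def)
next
  case (Cons a as)
  have "[v..<v + length (a # as)] = v # [Suc v..<Suc v + length as]"
    using upt_conv_Cons[of v "v + length (a # as)"] by simp
  then show ?case using Cons.IH[of "Suc v"] by (auto simp: equioriented_A_def)
qed

lemma walk_end_upt: "i \<le> j \<Longrightarrow> walk_end (equioriented_A n) i [i..<j] = j"
proof (induction "j - i" arbitrary: i)
  case (Suc d)
  then have "[i..<j] = i # [Suc i..<j]" by (simp add: upt_conv_Cons)
  then show ?case using Suc by (simp add: equioriented_A_def)
qed simp

lemma path_target_stretch: "i \<le> j \<Longrightarrow> path_target (equioriented_A n) (stretch i j) = j"
  by (simp add: path_target_def stretch_def walk_end_upt)

lemma paths_equioriented_A: "paths (equioriented_A n) = {stretch i j | i j. 1 \<le> i \<and> i \<le> j \<and> j \<le> n}"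
proof (intro equalityI subsetI)
  fix p assume "p \<in> paths (equioriented_A n)"
  then obtain v as where "p = (v, as)" "1 \<le> v" "v + length as \<le> n" "as = [v..<v + length as]"
    by (auto simp: paths_def is_walk_equioriented_A)
  then have "p = stretch v (v + length as) \<and> 1 \<le> v \<and> v \<le> v + length as \<and> v + length as \<le> n"
    by (simp add: stretch_def)
  then show "p \<in> {stretch i j | i j. 1 \<le> i \<and> i \<le> j \<and> j \<le> n}" by blast
qed (auto simp: paths_def stretch_def is_walk_equioriented_A)

lemma finite_paths_equioriented_A: "finite (paths (equioriented_A n))"
proof -
  have "paths (equioriented_A n) \<subseteq> case_prod stretch ` ({1..n} \<times> {1..n})"
    by (force simp: paths_equioriented_A)
  then show ?thesis by (rule finite_subset) simp
qed

lemma subspace_path_algebra: "cvec.subspace (path_algebra Q)"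
proof (rule cvec.subspaceI)
  fix x y assume "x \<in> path_algebra Q" "y \<in> path_algebra Q"
  moreover have "{p. (x + y) p \<noteq> 0} \<subseteq> {p. x p \<noteq> 0} \<union> {p. y p \<noteq> 0}" by auto
  ultimately show "x + y \<in> path_algebra Q"
    unfolding path_algebra_def mem_Collect_eq by (meson Un_least finite_UnI finite_subset subset_trans)
next
  fix c x assume "x \<in> path_algebra Q"
  then show "cscale c x \<in> path_algebra Q"
    by (auto simp: path_algebra_def cscale_def intro: finite_subset[of _ "{p. x p \<noteq> 0}"])
qed (simp add: path_algebra_def)

lemma path_elt_in_path_algebra: "p \<in> paths Q \<Longrightarrow> path_elt p \<in> path_algebra Q"
  by (auto simp: path_algebra_def path_elt_def)

lemma path_elt_stretch_in_path_algebra: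
  "1 \<le> i \<Longrightarrow> i \<le> j \<Longrightarrow> j \<le> n \<Longrightarrow> path_elt (stretch i j) \<in> path_algebra (equioriented_A n)"
  by (rule path_elt_in_path_algebra) (auto simp: paths_equioriented_A)

lemma append_upt: "i \<le> j \<Longrightarrow> j \<le> k \<Longrightarrow> [i..<j] @ [j..<k] = [i..<k]"
  using upt_add_eq_append[of i j "k - j"] by simp

text \<open>
  Trivial paths and arrows are both of the form \<open>stretch i j\<close>, so the following two formulas
  describe the vertex spaces as well as the maps of the regular modules.  In the convolution sum
  only the pairs with the given path as one factor survive; the other factor must then end, or
  start, where the given path starts or ends.
\<close>

lemma pa_mult_stretch_left:
  assumes "1 \<le> i" "i \<le> j" "j \<le> n"
  shows "pa_mult (equioriented_A n) (path_elt (stretch i j)) y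
    = (\<Sum>k\<in>{1..i}. cscale (y (stretch k i)) (path_elt (stretch k j)))"
proof
  fix r
  define A where "A = {(p, q). p \<in> paths (equioriented_A n) \<and> q \<in> paths (equioriented_A n) \<and>
       path_source p = path_target (equioriented_A n) q \<and> (path_source q, snd q @ snd p) = r}"
  define K where "K = {k \<in> {1..i}. r = stretch k j}"
  have "finite A"
    by (rule finite_subset[of _ "paths (equioriented_A n) \<times> paths (equioriented_A n)"])
      (auto simp: A_def finite_paths_equioriented_A)
  moreover have "(\<lambda>k. (stretch i j, stretch k i)) ` K \<subseteq> A"
    using assms by (auto simp: K_def A_def path_target_stretch paths_equioriented_A path_source_def)
      (auto simp: stretch_def append_upt)
  moreover have "path_elt (stretch i j) p * y q = 0"
    if pq: "(p, q) \<in> A - (\<lambda>k. (stretch i j, stretch k i)) ` K" for p q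
  proof -
    have "p \<noteq> stretch i j"
    proof
      assume p: "p = stretch i j"
      from pq obtain k l where q: "q = stretch k l" "1 \<le> k" "k \<le> l" "l \<le> n"
        by (auto simp: A_def paths_equioriented_A)
      with pq p have l: "l = i"
        by (auto simp: A_def path_target_stretch path_source_def) (simp add: stretch_def)
      with pq p q have "r = stretch k j"
        using assms by (auto simp: A_def path_source_def stretch_def append_upt)
      then show False using pq p q l by (auto simp: K_def)
    qed
    then show ?thesis by (simp add: path_elt_def)
  qed
  ultimately have "pa_mult (equioriented_A n) (path_elt (stretch i j)) y r
      = (\<Sum>(p, q)\<in>(\<lambda>k. (stretch i j, stretch k i)) ` K. path_elt (stretch i j) p * y q)"
    unfolding pa_mult_def A_def[symmetric] by (intro sum.mono_neutral_right) auto
  also have "\<dots> = (\<Sum>k\<in>K. y (stretch k i))"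
    by (subst sum.reindex) (auto simp: inj_on_def K_def stretch_eq_iff path_elt_def)
  also have "\<dots> = (\<Sum>k\<in>{1..i}. y (stretch k i) * path_elt (stretch k j) r)"
    by (rule sum.mono_neutral_cong_left) (auto simp: K_def path_elt_def)
  finally show "pa_mult (equioriented_A n) (path_elt (stretch i j)) y r
      = (\<Sum>k\<in>{1..i}. cscale (y (stretch k i)) (path_elt (stretch k j))) r"
    by (simp add: lincomb_apply)
qed

lemma pa_mult_stretch_right:
  assumes "1 \<le> i" "i \<le> j" "j \<le> n"
  shows "pa_mult (equioriented_A n) x (path_elt (stretch i j))
    = (\<Sum>k\<in>{j..n}. cscale (x (stretch j k)) (path_elt (stretch i k)))"
proof
  fix r
  define A where "A = {(p, q). p \<in> paths (equioriented_A n) \<and> q \<in> paths (equioriented_A n) \<and>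
       path_source p = path_target (equioriented_A n) q \<and> (path_source q, snd q @ snd p) = r}"
  define K where "K = {k \<in> {j..n}. r = stretch i k}"
  have "finite A"
    by (rule finite_subset[of _ "paths (equioriented_A n) \<times> paths (equioriented_A n)"])
      (auto simp: A_def finite_paths_equioriented_A)
  moreover have "(\<lambda>k. (stretch j k, stretch i j)) ` K \<subseteq> A"
    using assms by (auto simp: K_def A_def path_target_stretch paths_equioriented_A path_source_def)
      (auto simp: stretch_def append_upt)
  moreover have "x p * path_elt (stretch i j) q = 0"
    if pq: "(p, q) \<in> A - (\<lambda>k. (stretch j k, stretch i j)) ` K" for p q
  proof -
    have "q \<noteq> stretch i j"
    proof
      assume q: "q = stretch i j"
      from pq obtain l k where p: "p = stretch l k" "1 \<le> l" "l \<le> k" "k \<le> n"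
        by (auto simp: A_def paths_equioriented_A)
      with pq q assms have l: "l = j"
        by (auto simp: A_def path_target_stretch path_source_def) (simp add: stretch_def)
      with pq p q have "r = stretch i k"
        using assms by (auto simp: A_def path_source_def stretch_def append_upt)
      then show False using pq p q l by (auto simp: K_def)
    qed
    then show ?thesis by (simp add: path_elt_def)
  qed
  ultimately have "pa_mult (equioriented_A n) x (path_elt (stretch i j)) r
      = (\<Sum>(p, q)\<in>(\<lambda>k. (stretch j k, stretch i j)) ` K. x p * path_elt (stretch i j) q)"
    unfolding pa_mult_def A_def[symmetric] by (intro sum.mono_neutral_right) auto
  also have "\<dots> = (\<Sum>k\<in>K. x (stretch j k))"
    by (subst sum.reindex) (auto simp: inj_on_def K_def stretch_eq_iff path_elt_def)
  also have "\<dots> = (\<Sum>k\<in>{j..n}. x (stretch j k) * path_elt (stretch i k) r)"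
    by (rule sum.mono_neutral_cong_left) (auto simp: K_def path_elt_def)
  finally show "pa_mult (equioriented_A n) x (path_elt (stretch i j)) r
      = (\<Sum>k\<in>{j..n}. cscale (x (stretch j k)) (path_elt (stretch i k))) r"
    by (simp add: lincomb_apply)
qed

definition path_coord :: "('v, 'a) quiver \<Rightarrow> ('v, 'a) path \<Rightarrow> (('v, 'a) path \<Rightarrow> complex) \<Rightarrow> complex" where
  "path_coord Q p = (\<lambda>x. if x \<in> path_algebra Q then x p else 0)"

lemma path_elt_apply: "path_elt p r = (if r = p then 1 else 0)"
  by (simp add: path_elt_def)

lemma lincomb_path_coord_in_dual:
  "(\<Sum>k\<in>K. cscale (c k) (path_coord Q (p k))) \<in> dual_space (path_algebra Q)"
  by (auto simp: dual_space_def lincomb_apply path_coord_def cvec.subspace_add[OF subspace_path_algebra]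
      cvec.subspace_scale[OF subspace_path_algebra] cscale_apply
      algebra_simps sum.distrib sum_distrib_left)

lemma dual_space_lincomb:
  assumes F: "F \<in> dual_space U" and U: "cvec.subspace U" and u: "\<And>k. k \<in> K \<Longrightarrow> u k \<in> U"
  shows "F (\<Sum>k\<in>K. cscale (c k) (u k)) = (\<Sum>k\<in>K. c k * F (u k))"
proof -
  have add: "F (x + y) = F x + F y" if "x \<in> U" "y \<in> U" for x y
    using F that by (simp add: dual_space_def)
  have scale: "F (cscale a x) = a * F x" if "x \<in> U" for a x
    using F that by (simp add: dual_space_def)
  have F0: "F 0 = 0" using scale[of 0 0] cvec.subspace_0[OF U] by simp
  show ?thesis
    using u
  proof (induction K rule: infinite_finite_induct)
    case (insert k K)
    have "(\<Sum>l\<in>K. cscale (c l) (u l)) \<in> U"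
      using insert.prems by (intro cvec.subspace_sum[OF U] cvec.subspace_scale[OF U]) simp
    then have "F (cscale (c k) (u k) + (\<Sum>l\<in>K. cscale (c l) (u l)))
        = F (cscale (c k) (u k)) + F (\<Sum>l\<in>K. cscale (c l) (u l))"
      using insert.prems by (intro add cvec.subspace_scale[OF U]) simp_all
    then show ?case
      using insert by (simp only: sum.insert[OF insert(1,2)] scale[of "u k"] insertI1 insertI2)
  qed (simp_all add: F0)
qed

text \<open>
  Right multiplication by \<open>i \<rightarrow> \<dots> \<rightarrow> j\<close> sends the path \<open>j \<rightarrow> \<dots> \<rightarrow> k\<close> to \<open>i \<rightarrow> \<dots> \<rightarrow> k\<close> and all paths
  with another source to zero.  So the transposed action reads \<open>F\<close> off at the paths from \<open>i\<close> and
  assigns these values to the paths from \<open>j\<close>.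
\<close>

lemma dual_action_stretch:
  assumes ij: "1 \<le> i" "i \<le> j" "j \<le> n" and F: "F \<in> dual_space (path_algebra (equioriented_A n))"
  shows "(\<lambda>x. if x \<in> path_algebra (equioriented_A n)
        then F (pa_mult (equioriented_A n) x (path_elt (stretch i j))) else 0)
    = (\<Sum>k\<in>{j..n}. cscale (F (path_elt (stretch i k))) (path_coord (equioriented_A n) (stretch j k)))"
proof
  fix x
  have "F (pa_mult (equioriented_A n) x (path_elt (stretch i j)))
      = (\<Sum>k\<in>{j..n}. x (stretch j k) * F (path_elt (stretch i k)))"
    unfolding pa_mult_stretch_right[OF ij]
    using ij by (intro dual_space_lincomb[OF F subspace_path_algebra] path_elt_stretch_in_path_algebra) auto
  then show "(if x \<in> path_algebra (equioriented_A n)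
        then F (pa_mult (equioriented_A n) x (path_elt (stretch i j))) else 0)
    = (\<Sum>k\<in>{j..n}. cscale (F (path_elt (stretch i k))) (path_coord (equioriented_A n) (stretch j k))) x"
    by (simp add: lincomb_apply path_coord_def mult.commute)
qed

lemma lincomb_path_elt_apply:
  assumes "k \<in> {1..i}"
  shows "(\<Sum>l\<in>{1..i}. cscale (c l) (path_elt (stretch l i))) (stretch k i) = c k"
proof -
  have "(\<Sum>l\<in>{1..i}. c l * path_elt (stretch l i) (stretch k i)) = (\<Sum>l\<in>{1..i}. if l = k then c l else 0)"
    using assms by (intro sum.cong) (auto simp: path_elt_def stretch_eq_iff)
  then show ?thesis using assms by (simp add: lincomb_apply)
qed

lemma lincomb_path_coord_apply:
  assumes "1 \<le> i" "k \<in> {i..n}"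
  shows "(\<Sum>l\<in>{i..n}. cscale (c l) (path_coord (equioriented_A n) (stretch i l))) (path_elt (stretch i k)) = c k"
proof -
  have "(\<Sum>l\<in>{i..n}. c l * path_coord (equioriented_A n) (stretch i l) (path_elt (stretch i k)))
      = (\<Sum>l\<in>{i..n}. if l = k then c l else 0)"
    using assms by (intro sum.cong)
      (auto simp: path_coord_def path_elt_apply stretch_eq_iff path_elt_stretch_in_path_algebra)
  then show ?thesis using assms by (simp add: lincomb_apply)
qed

lemma path_algebra_rep_space:
  assumes "1 \<le> i" "i \<le> n"
  shows "space (path_algebra_rep (equioriented_A n)) i
    = range (\<lambda>c. \<Sum>k\<in>{1..i}. cscale (c k) (path_elt (stretch k i)))"
proof -
  let ?A = "path_algebra (equioriented_A n)"
  have act: "pa_mult (equioriented_A n) (path_elt (i, [])) y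
      = (\<Sum>k\<in>{1..i}. cscale (y (stretch k i)) (path_elt (stretch k i)))" for y
    using pa_mult_stretch_left[of i i n y] assms by (simp add: stretch_refl)
  have "(\<Sum>k\<in>{1..i}. cscale (c k) (path_elt (stretch k i)))
      \<in> pa_mult (equioriented_A n) (path_elt (i, [])) ` ?A" for c
  proof (rule image_eqI)
    show "(\<Sum>k\<in>{1..i}. cscale (c k) (path_elt (stretch k i))) \<in> ?A"
      using assms by (intro cvec.subspace_sum cvec.subspace_scale subspace_path_algebra
          path_elt_stretch_in_path_algebra) auto
    show "(\<Sum>k\<in>{1..i}. cscale (c k) (path_elt (stretch k i)))
      = pa_mult (equioriented_A n) (path_elt (i, [])) (\<Sum>k\<in>{1..i}. cscale (c k) (path_elt (stretch k i)))"
      unfolding act by (intro sum.cong refl) (simp only: lincomb_path_elt_apply)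
  qed
  then show ?thesis
    unfolding path_algebra_rep_def rep_of_module_def by (auto simp: act simp del: One_nat_def)
qed

lemma path_algebra_rep_basis:
  assumes "1 \<le> i" "i \<le> n"
  shows "is_basis_of i (\<lambda>k. path_elt (stretch k i)) (space (path_algebra_rep (equioriented_A n)) i)"
  by (rule is_basis_of_if_dual_points[where x = "\<lambda>l. stretch l i"])
    (auto simp: path_elt_def stretch_eq_iff path_algebra_rep_space[OF assms])

lemma path_algebra_rep_arrow:
  assumes "1 \<le> i" "i < n"
  shows "rmap (path_algebra_rep (equioriented_A n)) i (\<Sum>k\<in>{1..i}. cscale (c k) (path_elt (stretch k i)))
    = (\<Sum>k\<in>{1..i}. cscale (c k) (path_elt (stretch k (i + 1))))"
proof -
  have "rmap (path_algebra_rep (equioriented_A n)) i y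
      = (\<Sum>k\<in>{1..i}. cscale (y (stretch k i)) (path_elt (stretch k (i + 1))))" for y
    using pa_mult_stretch_left[of i "i + 1" n y] assms unfolding stretch_Suc[of i]
    by (simp add: path_algebra_rep_def rep_of_module_def src_equioriented_A)
  then show ?thesis by (simp only: lincomb_path_elt_apply cong: sum.cong)
qed

lemma dual_path_algebra_rep_space:
  assumes "1 \<le> i" "i \<le> n"
  shows "space (dual_path_algebra_rep (equioriented_A n)) i
    = range (\<lambda>c. \<Sum>k\<in>{i..n}. cscale (c k) (path_coord (equioriented_A n) (stretch i k)))"
proof -
  let ?D = "dual_space (path_algebra (equioriented_A n))"
  define act where "act F = (\<lambda>x. if x \<in> path_algebra (equioriented_A n)
      then F (pa_mult (equioriented_A n) x (path_elt (i, []))) else 0)" for F :: "_ \<Rightarrow> complex"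
  have act: "act F = (\<Sum>k\<in>{i..n}. cscale (F (path_elt (stretch i k))) (path_coord (equioriented_A n) (stretch i k)))"
    if "F \<in> ?D" for F
    using dual_action_stretch[of i i n F] assms that unfolding stretch_refl act_def by simp
  have "(\<Sum>k\<in>{i..n}. cscale (c k) (path_coord (equioriented_A n) (stretch i k))) \<in> act ` ?D" for c
  proof (rule image_eqI)
    show F: "(\<Sum>k\<in>{i..n}. cscale (c k) (path_coord (equioriented_A n) (stretch i k))) \<in> ?D"
      by (rule lincomb_path_coord_in_dual)
    show "(\<Sum>k\<in>{i..n}. cscale (c k) (path_coord (equioriented_A n) (stretch i k)))
      = act (\<Sum>k\<in>{i..n}. cscale (c k) (path_coord (equioriented_A n) (stretch i k)))"
      unfolding act[OF F] by (intro sum.cong refl) (simp only: lincomb_path_coord_apply[OF assms(1)])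
  qed
  moreover have "space (dual_path_algebra_rep (equioriented_A n)) i = act ` ?D"
    by (simp add: dual_path_algebra_rep_def rep_of_module_def act_def[abs_def])
  ultimately show ?thesis by (auto simp: act)
qed

lemma dual_path_algebra_rep_arrow:
  assumes "1 \<le> i" "i < n"
  shows "rmap (dual_path_algebra_rep (equioriented_A n)) i
      (\<Sum>k\<in>{i..n}. cscale (c k) (path_coord (equioriented_A n) (stretch i k)))
    = (\<Sum>k\<in>{i + 1..n}. cscale (c k) (path_coord (equioriented_A n) (stretch (i + 1) k)))"
proof -
  define F where "F = (\<Sum>k\<in>{i..n}. cscale (c k) (path_coord (equioriented_A n) (stretch i k)))"
  have "F \<in> dual_space (path_algebra (equioriented_A n))"
    unfolding F_def by (rule lincomb_path_coord_in_dual)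
  then have "rmap (dual_path_algebra_rep (equioriented_A n)) i F
      = (\<Sum>k\<in>{i + 1..n}. cscale (F (path_elt (stretch i k))) (path_coord (equioriented_A n) (stretch (i + 1) k)))"
    using dual_action_stretch[of i "i + 1" n F] assms unfolding stretch_Suc[of i]
    by (simp only: dual_path_algebra_rep_def rep_of_module_def rep.simps src_equioriented_A)
  also have "\<dots> = (\<Sum>k\<in>{i + 1..n}. cscale (c k) (path_coord (equioriented_A n) (stretch (i + 1) k)))"
    unfolding F_def using assms(1)
    by (intro sum.cong refl) (subst lincomb_path_coord_apply, auto)
  finally show ?thesis unfolding F_def .
qed


section \<open>A common basis for the degenerate flag variety\<close>

text \<open>
  The numbering is chosen so that the arrows preserve it.  The form of the path from \<open>i\<close> to \<open>j\<close>
  gets the number \<open>j + 1\<close>; thus the number \<open>i + 1\<close> belongs at the vertex \<open>i\<close> to the form of the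
  trivial path, which is in the kernel of the arrow \<open>i\<close>, and at the vertex \<open>i + 1\<close> to the trivial
  path itself, which is missing from its image.
\<close>

definition sum_basis :: "nat \<Rightarrow> nat \<Rightarrow> nat \<Rightarrow> (nat, nat) path + ((nat, nat) path \<Rightarrow> complex) \<Rightarrow> complex" where
  "sum_basis n i k = (if k \<le> i then case_sum (path_elt (stretch k i)) (\<lambda>_. 0)
     else case_sum (\<lambda>_. 0) (path_coord (equioriented_A n) (stretch i (k - 1))))"

lemma lincomb_sum_basis:
  assumes "i \<le> n"
  shows "(\<Sum>k\<in>{1..n + 1}. cscale (c k) (sum_basis n i k))
    = case_sum (\<Sum>k\<in>{1..i}. cscale (c k) (path_elt (stretch k i)))
        (\<Sum>k\<in>{i..n}. cscale (c (k + 1)) (path_coord (equioriented_A n) (stretch i k)))"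
proof
  fix z
  show "(\<Sum>k\<in>{1..n + 1}. cscale (c k) (sum_basis n i k)) z
    = case_sum (\<Sum>k\<in>{1..i}. cscale (c k) (path_elt (stretch k i)))
        (\<Sum>k\<in>{i..n}. cscale (c (k + 1)) (path_coord (equioriented_A n) (stretch i k))) z"
  proof (cases z)
    case (Inl r)
    have "(\<Sum>k\<in>{1..n + 1}. c k * sum_basis n i k z) = (\<Sum>k\<in>{1..i}. c k * path_elt (stretch k i) r)"
      using assms by (intro sum.mono_neutral_cong_right) (auto simp: sum_basis_def Inl)
    then show ?thesis by (simp add: lincomb_apply Inl del: One_nat_def)
  next
    case (Inr x)
    have "(\<Sum>k\<in>{1..n + 1}. c k * sum_basis n i k z)
        = (\<Sum>k\<in>{Suc i..Suc n}. c k * path_coord (equioriented_A n) (stretch i (k - 1)) x)"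
      by (intro sum.mono_neutral_cong_right) (auto simp: sum_basis_def Inr)
    also have "\<dots> = (\<Sum>k\<in>{i..n}. c (k + 1) * path_coord (equioriented_A n) (stretch i k) x)"
      by (simp add: sum.shift_bounds_cl_Suc_ivl del: sum.cl_ivl_Suc)
    finally show ?thesis unfolding lincomb_apply by (simp add: lincomb_apply Inr)
  qed
qed

abbreviation (input) regular_sum_rep :: "nat \<Rightarrow> (nat, nat, (nat, nat) path + ((nat, nat) path \<Rightarrow> complex)) rep" where
  "regular_sum_rep n \<equiv> rep_sum (path_algebra_rep (equioriented_A n)) (dual_path_algebra_rep (equioriented_A n))"

lemma sum_basis_is_basis:
  assumes i: "1 \<le> i" "i \<le> n"
  shows "is_basis_of (n + 1) (sum_basis n i) (space (regular_sum_rep n) i)"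
proof (rule is_basis_of_if_dual_points)
  show "sum_basis n i k (if l \<le> i then Inl (stretch l i) else Inr (path_elt (stretch i (l - 1))))
      = (if k = l then 1 else 0)" if kl: "k \<in> {1..n + 1}" "l \<in> {1..n + 1}" for k l
  proof (cases "l \<le> i")
    case True
    then show ?thesis using kl by (auto simp: sum_basis_def path_elt_def stretch_eq_iff)
  next
    case False
    then have "path_elt (stretch i (l - 1)) \<in> path_algebra (equioriented_A n)"
      using kl i by (intro path_elt_stretch_in_path_algebra) auto
    with False show ?thesis using kl
      by (auto simp: sum_basis_def path_coord_def) (auto simp: path_elt_def stretch_eq_iff)
  qed
next
  let ?f = "\<lambda>c. \<Sum>k\<in>{1..i}. cscale (c k) (path_elt (stretch k i))"
    and ?g = "\<lambda>d. \<Sum>k\<in>{i..n}. cscale (d k) (path_coord (equioriented_A n) (stretch i k))"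
  have split: "space (regular_sum_rep n) i = {case_sum (?f c) (?g d) | c d. True}"
    unfolding rep_sum_def rep.simps path_algebra_rep_space[OF i] dual_path_algebra_rep_space[OF i]
    by blast
  have glue: "case_sum (?f c) (?g d)
      = (\<Sum>k\<in>{1..n + 1}. cscale (if k \<le> i then c k else d (k - 1)) (sum_basis n i k))" for c d
    unfolding lincomb_sum_basis[OF i(2)] by (intro arg_cong2[of _ _ _ _ case_sum] sum.cong) auto
  show "space (regular_sum_rep n) i = range (\<lambda>c. \<Sum>k\<in>{1..n + 1}. cscale (c k) (sum_basis n i k))"
  proof (intro equalityI subsetI)
    fix h assume "h \<in> space (regular_sum_rep n) i"
    then obtain c d where "h = case_sum (?f c) (?g d)" unfolding split by blast
    then show "h \<in> range (\<lambda>c. \<Sum>k\<in>{1..n + 1}. cscale (c k) (sum_basis n i k))"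
      by - (rule range_eqI[of _ _ "\<lambda>k. if k \<le> i then c k else d (k - 1)"], simp only: glue)
  next
    fix h assume "h \<in> range (\<lambda>c. \<Sum>k\<in>{1..n + 1}. cscale (c k) (sum_basis n i k))"
    then obtain c where "h = case_sum (?f c) (?g (\<lambda>k. c (k + 1)))"
      unfolding lincomb_sum_basis[OF i(2)] by blast
    then show "h \<in> space (regular_sum_rep n) i"
      unfolding split mem_Collect_eq by (intro exI[of _ c] exI[of _ "\<lambda>k. c (k + 1)"] conjI TrueI)
  qed
qed

lemma regular_sum_rep_arrow:
  assumes i: "1 \<le> i" "i < n"
  shows "rmap (regular_sum_rep n) i (\<Sum>k\<in>{1..n + 1}. cscale (c k) (sum_basis n i k))
    = (\<Sum>k\<in>{1..n + 1} - {i + 1}. cscale (c k) (sum_basis n (i + 1) k))"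
proof -
  \<comment> \<open>Omitting an index amounts to a zero coefficient there, which keeps all sums over full bases.\<close>
  let ?c = "c(i + 1 := 0)"
  have "(\<Sum>k\<in>{1..n + 1} - {i + 1}. cscale (c k) (sum_basis n (i + 1) k))
      = (\<Sum>k\<in>{1..n + 1}. cscale (?c k) (sum_basis n (i + 1) k))"
    by (intro sum.mono_neutral_cong_left) auto
  also have "\<dots> = case_sum (\<Sum>k\<in>{1..i + 1}. cscale (?c k) (path_elt (stretch k (i + 1))))
      (\<Sum>k\<in>{i + 1..n}. cscale (?c (k + 1)) (path_coord (equioriented_A n) (stretch (i + 1) k)))"
    using i by (intro lincomb_sum_basis) simp
  also have "(\<Sum>k\<in>{1..i + 1}. cscale (?c k) (path_elt (stretch k (i + 1))))
      = (\<Sum>k\<in>{1..i}. cscale (c k) (path_elt (stretch k (i + 1))))"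
    by (intro sum.mono_neutral_cong_right) auto
  also have "\<dots> = rmap (path_algebra_rep (equioriented_A n)) i
      (\<Sum>k\<in>{1..i}. cscale (c k) (path_elt (stretch k i)))"
    using path_algebra_rep_arrow[OF i] by simp
  also have "(\<Sum>k\<in>{i + 1..n}. cscale (?c (k + 1)) (path_coord (equioriented_A n) (stretch (i + 1) k)))
      = (\<Sum>k\<in>{i + 1..n}. cscale (c (k + 1)) (path_coord (equioriented_A n) (stretch (i + 1) k)))"
    by (intro sum.cong) auto
  also have "\<dots> = rmap (dual_path_algebra_rep (equioriented_A n)) i
      (\<Sum>k\<in>{i..n}. cscale (c (k + 1)) (path_coord (equioriented_A n) (stretch i k)))"
    using dual_path_algebra_rep_arrow[OF i, of "\<lambda>k. c (k + 1)"] by simp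
  finally show ?thesis
    unfolding lincomb_sum_basis[OF less_imp_le[OF i(2)]]
    by (simp add: rep_sum_def comp_def del: One_nat_def)
qed

definition flag_rep :: "nat \<Rightarrow> (nat \<Rightarrow> 'x \<Rightarrow> complex) \<Rightarrow> ('x \<Rightarrow> complex) set \<Rightarrow> (nat, nat, 'x) rep" where
  "flag_rep n w W = \<lparr>space = (\<lambda>_. W), rmap = (\<lambda>i. pr (n + 1) w (i + 1))\<rparr>"

lemma degenerate_flag_variety_eq_quiver_grass:
  "degenerate_flag_variety n w W = quiver_grass (equioriented_A n) (\<lambda>i. i) (flag_rep n w W)"
  by (simp add: degenerate_flag_variety_def quiver_grass_def degenerate_flag_pts_def
      quiver_grass_pts_def flag_rep_def equioriented_A_def)

theorem proposition2p7:
  fixes n :: nat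
    and w :: "nat \<Rightarrow> 'x \<Rightarrow> complex"
    and W :: "('x \<Rightarrow> complex) set"
  assumes "n \<ge> 1"
    and "is_basis_of (n + 1) w W"
  shows "isomorphic
    (quiver_grass (equioriented_A n)
      (dim_vec_rep (path_algebra_rep (equioriented_A n)))
      (rep_sum (path_algebra_rep (equioriented_A n)) (dual_path_algebra_rep (equioriented_A n))))
    (degenerate_flag_variety n w W)"
  unfolding degenerate_flag_variety_eq_quiver_grass
proof (rule isomorphic_quiver_grass_if_matching_bases[where m = "n + 1" and \<beta> = "sum_basis n"
      and \<gamma> = "\<lambda>_. w" and Z = "\<lambda>i. {i + 1}"])
  show "dim_vec_rep (path_algebra_rep (equioriented_A n)) i = i" if "i \<in> verts (equioriented_A n)" for i
    using that is_basis_of_dim[OF path_algebra_rep_basis]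
    by (simp add: dim_vec_rep_def equioriented_A_def)
  show "is_basis_of (n + 1) (sum_basis n i) (space (regular_sum_rep n) i)"
    if "i \<in> verts (equioriented_A n)" for i
    using that by (intro sum_basis_is_basis) (auto simp: equioriented_A_def)
  show "rmap (regular_sum_rep n) a (\<Sum>k\<in>{1..n + 1}. cscale (c k) (sum_basis n (src (equioriented_A n) a) k))
      = (\<Sum>k\<in>{1..n + 1} - {a + 1}. cscale (c k) (sum_basis n (tgt (equioriented_A n) a) k))"
    if "a \<in> arrows (equioriented_A n)" for a c
    using that regular_sum_rep_arrow[of a n c] by (simp add: equioriented_A_def)
  show "rmap (flag_rep n w W) a (\<Sum>k\<in>{1..n + 1}. cscale (c k) (w k))
      = (\<Sum>k\<in>{1..n + 1} - {a + 1}. cscale (c k) (w k))" for a c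
    unfolding flag_rep_def rep.simps by (rule pr_lincomb[OF assms(2)])
qed (use assms(2) in \<open>auto simp: equioriented_A_def flag_rep_def\<close>)

end
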